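(* Let $\chi_0=1$, let $J=J(x,y)$ be a (possibly complex-valued, not necessarily symmetric) kernel on $\mathbb{R}^n\times\mathbb{R}^n$, and let $R(t)=t^{\beta}L(t)$ be a regular varying function with index $\beta\in\mathbb{R}$ ($L$ slowly varying). Put $R_k:=R(k)$. Assume there is a positive integer $N$ such that either (i) $u_0\in L^1(\mathbb{R}^n)\cap L^\infty(\mathbb{R}^n)$, $\sup_{x\in\mathbb{R}^n}\int_{\mathbb{R}^n}|J(x,y)|\,dy<\infty$, and $|J_k(x,y)|\leq R_k$ for all $x,y\in\mathbb{R}^n$ and all $k=N,N+1,\ldots$; or (ii) there is $1\leq p\leq\infty$ such that $\mathcal{J}^ku_0\in L^p(\mathbb{R}^n)$ for $k=1,2,\ldots,N-1$, and $\|\mathcal{J}^ku_0\|_{L^p}\leq R_k$ for $k=N,N+1,\ldots$. Then the solution $u(t)$ of $$\partial_tu(x,t)=\int_{\mathbb{R}^n}J(x,y)u(y,t)\,dy-u(x,t),\quad (x,t)\in\mathbb{R}^n\times(0,\infty),$$ with initial value $u_0$ satisfies $$\|u(t)\|_{L^q}\lesssim t^{\beta}L(t)\quad\text{as } t\to\infty,$$ where $q=\infty$ in case (i) and $q=p$ in case (ii).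
   Context: $\mathcal{J}$ is the integral operator $\mathcal{J}u(x)=\int_{\mathbb{R}^n}J(x,y)u(y)\,dy$, $\mathcal{J}^k$ is its $k$-fold composition ($\mathcal{J}^0$ the identity), and $J_k$ is the kernel of $\mathcal{J}^k$: $$J_k(x,y)=\int_{(\mathbb{R}^n)^{k-1}}J(x,y_1)J(y_1,y_2)\cdots J(y_{k-1},y)\,dy_{k-1}\cdots dy_1 .$$ By definition, the solution of $\partial_t u=\mathcal{J}u-\chi_0u$ with initial value $u_0$ is the function $u(t)=e^{-\chi_0t}\sum_{k=0}^\infty\frac{t^k}{k!}\mathcal{J}^ku_0$. A measurable function $R:[N_0,\infty)\to(0,\infty)$, $N_0>0$, is regular varying with index $\beta\in\mathbb{R}$ if $\lim_{s\to\infty}R(\lambda s)/R(s)=\lambda^\beta$ for all $\lambda>0$; it is slowly varying if $\beta=0$. Every regular varying function of index $\beta$ has the form $s^\beta L(s)$ with $L$ slowly varying. The notation $f(t)\lesssim g(t)$ as $t\to\infty$ means that there are constants $C,t_0>0$ with $f(t)\le Cg(t)$ for all $t\ge t_0$.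
   Formalization: In case (ii) the initial value u_0 itself is also assumed to lie in L^p; without this the claim fails (J=0 and u_0 not in L^p give u(t)=e^{-t}u_0, not in L^p). *)

theory Defs
  imports "HOL-Analysis.Analysis" "HOL-Probability.Essential_Supremum"
begin

definition Lp_norm :: "ennreal \<Rightarrow> ('a::euclidean_space \<Rightarrow> complex) \<Rightarrow> ennreal" where
  "Lp_norm p f =
     (if p = \<infinity> then esssup lebesgue (\<lambda>x. ennreal (norm (f x)))
      else let I = (\<integral>\<^sup>+ x. ennreal (norm (f x) powr enn2real p) \<partial>lebesgue)
           in if I = \<infinity> then \<infinity> else ennreal (enn2real I powr (1 / enn2real p)))"

definition Lp_space :: "ennreal \<Rightarrow> ('a::euclidean_space \<Rightarrow> complex) set" where
  "Lp_space p = {f \<in> borel_measurable lebesgue. Lp_norm p f < \<infinity>}"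

definition integral_op ::
  "('a::euclidean_space \<Rightarrow> 'a \<Rightarrow> complex) \<Rightarrow> ('a \<Rightarrow> complex) \<Rightarrow> 'a \<Rightarrow> complex" where
  "integral_op J u x = (\<integral>y. J x y * u y \<partial>lebesgue)"

text \<open>For \<open>k \<ge> 1\<close>, \<open>iter_kernel J k x y\<close> integrates
  \<open>J(x,y\<^sub>1) J(y\<^sub>1,y\<^sub>2) \<dots> J(y\<^sub>k\<^sub>-\<^sub>1,y)\<close> over \<open>(y\<^sub>1,\<dots>,y\<^sub>k\<^sub>-\<^sub>1)\<close>: the factors are the
  consecutive pairs of the points \<open>y\<^sub>0 = x, y\<^sub>1, \<dots>, y\<^sub>k\<^sub>-\<^sub>1, y\<^sub>k = y\<close>. For \<open>k = 1\<close> the integration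
  is over a one-point space, so the value is \<open>J x y\<close>. The value at \<open>k = 0\<close> has no meaning.\<close>
definition iter_kernel ::
  "('a::euclidean_space \<Rightarrow> 'a \<Rightarrow> complex) \<Rightarrow> nat \<Rightarrow> 'a \<Rightarrow> 'a \<Rightarrow> complex" where
  "iter_kernel J k x y =
     (\<integral>z. (\<Prod>i<k. J ((z(0 := x, k := y)) i) ((z(0 := x, k := y)) (Suc i)))
        \<partial>(Pi\<^sub>M {1..<k} (\<lambda>_. lebesgue)))"

text \<open>The series is taken pointwise in \<open>x\<close>.\<close>
definition solution ::
  "('a::euclidean_space \<Rightarrow> 'a \<Rightarrow> complex) \<Rightarrow> real \<Rightarrow> ('a \<Rightarrow> complex) \<Rightarrow> real \<Rightarrow> 'a \<Rightarrow> complex" where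
  "solution J \<chi>\<^sub>0 u\<^sub>0 t x =
     of_real (exp (- \<chi>\<^sub>0 * t)) * (\<Sum>k. of_real (t ^ k / fact k) * (integral_op J ^^ k) u\<^sub>0 x)"

text \<open>\<open>R\<close> is a function \<open>[a,\<infinity>) \<rightarrow> (0,\<infinity>)\<close>; its values below \<open>a\<close> are irrelevant.\<close>
definition regularly_varying :: "real \<Rightarrow> real \<Rightarrow> (real \<Rightarrow> real) \<Rightarrow> bool" where
  "regularly_varying a \<beta> R \<longleftrightarrow>
     a > 0 \<and> R \<in> borel_measurable (lebesgue_on {a..}) \<and> (\<forall>s\<ge>a. R s > 0) \<and>
     (\<forall>c>0. ((\<lambda>s. R (c * s) / R s) \<longlongrightarrow> c powr \<beta>) at_top)"

definition slowly_varying :: "real \<Rightarrow> (real \<Rightarrow> real) \<Rightarrow> bool" where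
  "slowly_varying a L \<longleftrightarrow> regularly_varying a 0 L"

definition asymp_le :: "(real \<Rightarrow> ennreal) \<Rightarrow> (real \<Rightarrow> real) \<Rightarrow> bool" where
  "asymp_le f g \<longleftrightarrow> (\<exists>C>0. \<exists>t\<^sub>0>0. \<forall>t\<ge>t\<^sub>0. f t \<le> ennreal (C * g t))"

end

theory Submission
  imports Defs
begin

text \<open>
  Put \<open>b k\<close> for a bound of \<open>\<parallel>\<J>\<^sup>k u\<^sub>0\<parallel>\<close>. The solution is \<open>exp (- t) \<Sum>\<^sub>k (t\<^sup>k / k!) \<J>\<^sup>k u\<^sub>0\<close>, so by the triangle
  inequality its norm is at most \<open>exp (- t) \<Sum>\<^sub>k (t\<^sup>k / k!) b k\<close>, the expectation of \<open>b\<close> at a Poisson variable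
  of mean \<open>t\<close>. Such a variable concentrates at \<open>t\<close>, and for large \<open>k\<close> a multiple of \<open>R k\<close> serves as \<open>b k\<close>. As \<open>R\<close>
  grows and decays at most like a power, the expectation is at most of the order of \<open>R t\<close>.

  Concentration is used only through moments. \<open>R\<close> is comparable on octaves: there are \<open>X\<close>
  and \<open>M\<close> such that \<open>R s\<close> and \<open>R (c * s)\<close> differ at most by the factor \<open>M\<close> for \<open>s \<ge> X\<close> and
  \<open>1 \<le> c \<le> 2\<close> (\<open>regularly_varying_comparable_on_octave\<close>). This uniformity in \<open>c\<close> is where the measurability
  of \<open>R\<close> enters. Iterating it gives \<open>b k \<le> C * R t * ((k / t)\<^sup>m + (t / (k + 1))\<^sup>m)\<close> for all \<open>k\<close> and all
  large \<open>t\<close> (\<open>regularly_varying_two_sided_power_bound\<close>), and the positive and negative Poisson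
  moments on the right are bounded in \<open>t\<close>.

  The series defining the solution is pointwise, so the triangle inequality in \<open>L\<^sup>p\<close> has to include its
  convergence almost everywhere (\<open>Lp_norm_series_le\<close>); for finite \<open>p\<close> this is Jensen's inequality and
  monotone convergence.

  This settles the case where the norms of \<open>\<J>\<^sup>k u\<^sub>0\<close> are bounded by \<open>R k\<close>. The case where the kernels
  are bounded reduces to it, with \<open>p = \<infinity>\<close>: by Fubini's theorem \<open>\<J>\<^sup>k u\<^sub>0 (x) = \<integral> J\<^sub>k(x,y) u\<^sub>0(y) dy\<close> for
  \<open>k \<ge> 1\<close> (\<open>integral_op_funpow_eq_iter_kernel\<close>), so \<open>\<bar>\<J>\<^sup>k u\<^sub>0\<bar> \<le> R k * \<parallel>u\<^sub>0\<parallel>\<^sub>1\<close> for \<open>k \<ge> N\<close>, while for smaller \<open>k\<close> the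
  bound on the row integrals of \<open>J\<close> shows that \<open>\<J>\<^sup>k u\<^sub>0\<close> is bounded.
\<close>

section \<open>Regularly varying functions between two powers\<close>

text \<open>The exceptional dilations \<open>v\<close> between 1 and 4: those for which \<open>R (v * s)\<close> and \<open>R s\<close> differ by more
  than the factor \<open>K\<close>. The window \<open>[1, 4]\<close> is larger than an octave so that it still has an octave in common
  with its image under any dilation by a factor between 1 and 2.\<close>
definition incomparable_scales :: "(real \<Rightarrow> real) \<Rightarrow> real \<Rightarrow> real \<Rightarrow> real set" where
  "incomparable_scales R K s = {v \<in> {1..4}. \<not> (R (v * s) \<le> K * R s \<and> R s \<le> K * R (v * s))}"

lemma incomparable_scales_lmeasurable:
  assumes R: "regularly_varying a \<beta> R" and s: "s \<ge> a"
  shows "incomparable_scales R K s \<in> lmeasurable"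
proof -
  have a: "a > 0" using R by (simp add: regularly_varying_def)
  define R' where "R' = (\<lambda>x. indicator {a..} x *\<^sub>R R x)"
  have R': "R' \<in> borel_measurable lebesgue"
    using R unfolding regularly_varying_def R'_def
    by (subst (asm) borel_measurable_restrict_space_iff) auto
  define g where "g = (\<lambda>v. R' (v * s))"
  have "(\<lambda>v. R' (s *\<^sub>R v)) \<in> borel_measurable lebesgue"
    by (rule measurable_compose[OF lebesgue_measurable_scaling R'])
  then have [measurable]: "g \<in> borel_measurable lebesgue"
    by (simp add: g_def mult.commute)
  have [measurable]: "{1..4::real} \<in> sets lebesgue" by simp
  have "g v = R (v * s)" if "v \<ge> 1" for v
    using mult_mono[of 1 v a s] that a s by (simp add: g_def R'_def)
  then have eq: "incomparable_scales R K s
      = {v \<in> {1..4}. \<not> (g v \<le> K * R s \<and> R s \<le> K * g v)}"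
    unfolding incomparable_scales_def by auto
  have "{v \<in> space lebesgue. v \<in> {1..4} \<and> \<not> (g v \<le> K * R s \<and> R s \<le> K * g v)} \<in> sets lebesgue"
    by measurable
  then have "incomparable_scales R K s \<in> sets lebesgue"
    by (simp add: eq)
  moreover have "incomparable_scales R K s \<subseteq> {1..4}"
    by (auto simp: incomparable_scales_def)
  ultimately show ?thesis
    by (meson fmeasurableI2 lmeasurable_interval(1) box_real(2) lmeasurable_cbox)
qed

text \<open>For each fixed \<open>v\<close> in \<open>[1, 4]\<close> the ratio \<open>R (v * s) / R s\<close> tends to \<open>v powr \<beta>\<close>, which lies strictly between
  \<open>1 / K\<close> and \<open>K\<close>; so \<open>v\<close> is eventually not exceptional, and dominated convergence applies to the indicators.\<close>
lemma measure_incomparable_scales_tendsto_0: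
  assumes R: "regularly_varying a \<beta> R" and K: "K > 4 powr \<bar>\<beta>\<bar>"
  shows "((\<lambda>s. measure lebesgue (incomparable_scales R K s)) \<longlongrightarrow> 0) at_top"
proof -
  define S where "S s = (if s \<ge> a then incomparable_scales R K s else {})" for s
  have S: "S s \<in> lmeasurable" for s
    using incomparable_scales_lmeasurable[OF R] by (simp add: S_def)
  have K1: "K > 1"
    using K ge_one_powr_ge_zero[of 4 "\<bar>\<beta>\<bar>"] by linarith
  have lim: "((\<lambda>s. indicat_real (S s) v) \<longlongrightarrow> 0) at_top" for v
  proof (cases "v \<in> {1..4}")
    case True
    then have v: "1 \<le> v" "v \<le> 4" by auto
    have up: "v powr \<beta> < K"
    proof -
      have "v powr \<beta> \<le> v powr \<bar>\<beta>\<bar>" using v by (intro powr_mono) auto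
      also have "\<dots> \<le> 4 powr \<bar>\<beta>\<bar>" using v by (intro powr_mono2) auto
      finally show ?thesis using K by linarith
    qed
    have lo: "1 / K < v powr \<beta>"
    proof -
      have "1 / K < 1 / 4 powr \<bar>\<beta>\<bar>" using K K1 by (intro divide_strict_left_mono) auto
      also have "\<dots> \<le> 1 / v powr \<bar>\<beta>\<bar>"
        using v by (intro divide_left_mono powr_mono2) auto
      also have "\<dots> = v powr (- \<bar>\<beta>\<bar>)" by (simp add: powr_minus_divide)
      also have "\<dots> \<le> v powr \<beta>" using v by (intro powr_mono) auto
      finally show ?thesis .
    qed
    have l: "((\<lambda>s. R (v * s) / R s) \<longlongrightarrow> v powr \<beta>) at_top"
      using R v by (auto simp: regularly_varying_def)
    have "\<forall>\<^sub>F s in at_top. s \<ge> a \<and> R (v * s) / R s < K \<and> 1 / K < R (v * s) / R s"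
      using order_tendstoD(2)[OF l up] order_tendstoD(1)[OF l lo] eventually_ge_at_top[of a]
      by eventually_elim auto
    then have "\<forall>\<^sub>F s in at_top. indicat_real (S s) v = 0"
    proof eventually_elim
      case (elim s)
      then have "R s > 0" using R by (auto simp: regularly_varying_def)
      then show ?case using elim K1
        by (auto simp: S_def incomparable_scales_def indicator_def field_simps)
    qed
    then show ?thesis by (rule tendsto_eventually)
  next
    case False
    then have "indicat_real (S s) v = 0" for s
      by (auto simp: S_def incomparable_scales_def)
    then show ?thesis by simp
  qed
  have "((\<lambda>s. \<integral>v. indicat_real (S s) v \<partial>lebesgue) \<longlongrightarrow> (\<integral>v. (0::real) \<partial>(lebesgue :: real measure))) at_top"
  proof (rule integral_dominated_convergence_at_top[where s = "\<lambda>s. indicat_real (S s)"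
      and f = "\<lambda>_. 0" and w = "indicat_real {1..4}"])
    show "integrable lebesgue (indicat_real {1..4::real})"
      using lmeasurable_cbox[of 1 "4::real"] by (intro integrable_real_indicator) (auto simp: fmeasurable_def)
    show "\<forall>\<^sub>F i in at_top. AE x in lebesgue. norm (indicat_real (S i) x) \<le> indicat_real {1..4} x"
      by (auto simp: S_def incomparable_scales_def indicator_def)
    show "indicat_real (S s) \<in> borel_measurable lebesgue" for s
      using S[of s] by (intro borel_measurable_indicator) (simp add: fmeasurable_def)
  qed (use lim in auto)
  then have "((\<lambda>s. measure lebesgue (S s)) \<longlongrightarrow> 0) at_top"
    using S by (simp add: fmeasurable_def)
  moreover have "\<forall>\<^sub>F s in at_top. measure lebesgue (S s) = measure lebesgue (incomparable_scales R K s)"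
    using eventually_ge_at_top[of a] by eventually_elim (simp add: S_def)
  ultimately show ?thesis by (rule Lim_transform_eventually)
qed

text \<open>The definition of regular variation compares \<open>R (c * s)\<close> with \<open>R s\<close> one \<open>c\<close> at a time. For
  uniformity in \<open>c\<close>, compare both with \<open>R (w * s)\<close>, for some \<open>w\<close> in \<open>[2, 4]\<close> depending on \<open>s\<close> and \<open>c\<close>.
  The values of \<open>w\<close> that are bad for \<open>s\<close>, and the \<open>c\<close>-fold dilates of those bad for \<open>c * s\<close>, have total
  measure less than 2 once \<open>s\<close> is large, so they cannot fill \<open>[2, 4]\<close>.\<close>
lemma regularly_varying_comparable_on_octave:
  assumes R: "regularly_varying a \<beta> R"
  obtains X M where "X \<ge> a" "M \<ge> 1"
    "\<And>s c. s \<ge> X \<Longrightarrow> 1 \<le> c \<Longrightarrow> c \<le> 2 \<Longrightarrow> R (c * s) \<le> M * R s \<and> R s \<le> M * R (c * s)"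
proof -
  define K where "K = 4 powr \<bar>\<beta>\<bar> + 1"
  have K1: "K \<ge> 1" by (simp add: K_def)
  let ?B = "incomparable_scales R K"
  have "\<forall>\<^sub>F s in at_top. measure lebesgue (?B s) < 1 / 2"
    by (rule order_tendstoD[OF measure_incomparable_scales_tendsto_0[OF R]]) (auto simp: K_def)
  then obtain X0 where X0: "\<And>s. s \<ge> X0 \<Longrightarrow> measure lebesgue (?B s) < 1 / 2"
    by (auto simp: eventually_at_top_linorder)
  define X where "X = max X0 a"
  have a: "a > 0" using R by (simp add: regularly_varying_def)
  have "R (c * s) \<le> K\<^sup>2 * R s \<and> R s \<le> K\<^sup>2 * R (c * s)" if s: "s \<ge> X" and c: "1 \<le> c" "c \<le> 2" for s c
  proof -
    have "s \<le> c * s"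
      using s c a mult_right_mono[of 1 c s] by (simp add: X_def)
    then have cs: "c * s \<ge> X" using s by linarith
    \<comment> \<open>\<open>w\<close> is outside \<open>D\<close> iff \<open>w / c\<close> is a good dilation for the base point \<open>c * s\<close>
      or lies outside of \<open>[1, 4]\<close>, and the latter is impossible for \<open>w\<close> in \<open>[2, 4]\<close>.\<close>
    define D where "D = (\<lambda>v. c * v) ` ?B (c * s)"
    have B: "?B s \<in> lmeasurable" and B': "?B (c * s) \<in> lmeasurable"
      using incomparable_scales_lmeasurable[OF R] s cs by (auto simp: X_def)
    have D: "D \<in> lmeasurable"
    proof (rule fmeasurableI2)
      have "D = (*\<^sub>R) (1 / c) -` ?B (c * s) \<inter> space lebesgue"
        unfolding D_def using c by (auto simp: image_iff field_simps intro!: exI[of _ "_ / c"] bexI[of _ "_ / c"])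
      then show "D \<in> sets lebesgue"
        using measurable_sets[OF lebesgue_measurable_scaling[of "1 / c"], of "?B (c * s)"] B' by (simp add: fmeasurable_def)
      show "D \<subseteq> cbox 0 8"
        using c mult_mono[of c 2 _ 4] unfolding D_def incomparable_scales_def by fastforce
    qed simp
    have mD: "measure lebesgue D = c * measure lebesgue (?B (c * s))"
      using measure_lebesgue_affine[of c "0::real" "?B (c * s)"] c by (simp add: D_def)
    have "measure lebesgue (?B s \<union> D) \<le> measure lebesgue (?B s) + measure lebesgue D"
      using B D by (intro measure_Un_le) (auto simp: fmeasurable_def)
    also have "\<dots> < 1 / 2 + 2 * (1 / 2)"
      unfolding mD using X0[of s] X0[of "c * s"] s cs c
      by (intro add_less_le_mono mult_mono) (auto simp: X_def intro: less_imp_le)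
    finally have small: "measure lebesgue (?B s \<union> D) < 2" by simp
    have "\<not> {2..4} \<subseteq> ?B s \<union> D"
    proof
      assume "{2..4} \<subseteq> ?B s \<union> D"
      then have "measure lebesgue {2..4::real} \<le> measure lebesgue (?B s \<union> D)"
        using B D by (intro measure_mono_fmeasurable) auto
      then show False using small by simp
    qed
    then obtain w where w: "2 \<le> w" "w \<le> 4" "w \<notin> ?B s" "w \<notin> D"
      by (meson UnI1 UnI2 atLeastAtMost_iff subsetI)
    have "w / c \<in> {1..4}"
      using w c mult_mono[of 1 c 4 4] by (auto simp: field_simps)
    moreover have "w / c \<notin> ?B (c * s)"
      using w c unfolding D_def by (metis image_eqI nonzero_mult_div_cancel_left not_one_le_zero
          times_divide_eq_right)
    ultimately have 1: "R (w * s) \<le> K * R (c * s)" "R (c * s) \<le> K * R (w * s)"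
      using c by (auto simp: incomparable_scales_def)
    have 2: "R (w * s) \<le> K * R s" "R s \<le> K * R (w * s)"
      using w by (auto simp: incomparable_scales_def)
    have "R (c * s) \<le> K * (K * R s)" "R s \<le> K * (K * R (c * s))"
      using 1 2 K1 by (meson mult_left_mono order_trans zero_le_one)+
    then show ?thesis by (simp add: power2_eq_square mult.assoc)
  qed
  moreover have "X \<ge> a" by (simp add: X_def)
  moreover have "K\<^sup>2 \<ge> 1" using K1 by simp
  ultimately show ?thesis using that by blast
qed

text \<open>A weak form of Potter's bounds, with some exponent \<open>m\<close> unrelated to \<open>\<beta>\<close>: each octave between \<open>x\<close> and \<open>y\<close>
  costs a factor of at most \<open>2 ^ m\<close>, and there are about \<open>log 2 (y / x)\<close> octaves. The leading \<open>2 ^ m\<close>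
  pays for the last, incomplete one.\<close>
lemma regularly_varying_power_bounds:
  assumes R: "regularly_varying a \<beta> R"
  obtains X m where "X \<ge> a"
    "\<And>x y. X \<le> x \<Longrightarrow> x \<le> y \<Longrightarrow> R y \<le> 2 ^ m * (y / x) ^ m * R x"
    "\<And>x y. X \<le> x \<Longrightarrow> x \<le> y \<Longrightarrow> R x \<le> 2 ^ m * (y / x) ^ m * R y"
proof -
  obtain X M where X: "X \<ge> a" and M: "M \<ge> 1"
    and XM: "\<And>s c. s \<ge> X \<Longrightarrow> 1 \<le> c \<Longrightarrow> c \<le> 2 \<Longrightarrow> R (c * s) \<le> M * R s \<and> R s \<le> M * R (c * s)"
    using regularly_varying_comparable_on_octave[OF R] by blast
  have a: "a > 0" using R by (simp add: regularly_varying_def)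
  have pos: "R s > 0" if "s \<ge> X" for s using that X R by (simp add: regularly_varying_def)
  obtain m where m: "M < 2 ^ m" using real_arch_pow[of 2 M] by auto
  have oct: "R y \<le> 2 ^ m * R x \<and> R x \<le> 2 ^ m * R y" if "X \<le> x" "x \<le> y" "y \<le> 2 * x" for x y
  proof -
    have "R y \<le> M * R x \<and> R x \<le> M * R y"
      using XM[of x "y / x"] that a X by (simp add: field_simps)
    moreover have "M * R z \<le> 2 ^ m * R z" if "z \<ge> X" for z
      using m pos[OF that] by (intro mult_right_mono) auto
    ultimately show ?thesis using that by (meson order_trans)
  qed
  have *: "R y \<le> 2 ^ m * (y / x) ^ m * R x \<and> R x \<le> 2 ^ m * (y / x) ^ m * R y"
    if "X \<le> x" "x \<le> y" "y \<le> 2 ^ n * x" for n x y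
    using that
  proof (induction n arbitrary: y)
    case 0
    then have "y = x" "x > 0" using X a by auto
    then show ?case using oct[of x x] 0 by simp
  next
    case (Suc n)
    have x: "x > 0" using Suc.prems X a by linarith
    show ?case
    proof (cases "y \<le> 2 * x")
      case True
      have "1 \<le> (y / x) ^ m" using x Suc.prems by (intro one_le_power) (simp add: field_simps)
      then have "2 ^ m * R z \<le> 2 ^ m * (y / x) ^ m * R z" if "z \<ge> X" for z
        using pos[OF that] by (intro mult_right_mono) auto
      then show ?thesis using oct[of x y] Suc.prems True by (meson order_trans)
    next
      case False
      have IH: "R (y / 2) \<le> 2 ^ m * (y / 2 / x) ^ m * R x \<and> R x \<le> 2 ^ m * (y / 2 / x) ^ m * R (y / 2)"
        using Suc.prems False by (intro Suc.IH) auto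
      have "X \<le> y / 2" using Suc.prems False by simp
      then have o: "R y \<le> 2 ^ m * R (y / 2)" "R (y / 2) \<le> 2 ^ m * R y"
        using oct[of "y / 2" y] Suc.prems X a by auto
      have e: "(2::real) ^ m * (y / 2 / x) ^ m = (y / x) ^ m"
        by (simp flip: power_mult_distrib)
      have "R y \<le> 2 ^ m * ((y / x) ^ m * R x)"
        using o(1) IH unfolding e by (meson mult_left_mono order_trans zero_le_numeral zero_le_power)
      moreover have "R x \<le> (y / x) ^ m * (2 ^ m * R y)"
        using o(2) IH x Suc.prems unfolding e 
        by (smt (verit) divide_nonneg_pos mult_left_mono zero_le_power)
      ultimately show ?thesis by (simp add: ac_simps)
    qed
  qed
  have "R y \<le> 2 ^ m * (y / x) ^ m * R x \<and> R x \<le> 2 ^ m * (y / x) ^ m * R y"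
    if "X \<le> x" "x \<le> y" for x y
  proof -
    have "x > 0" using that X a by linarith
    obtain n where "y / x < 2 ^ n" using real_arch_pow[of 2 "y / x"] by auto
    then show ?thesis using *[of x y n] that \<open>x > 0\<close> by (simp add: field_simps)
  qed
  then show ?thesis using that X by blast
qed

section \<open>Poisson averages\<close>

lemma exp_inverse_le: "t \<ge> 1 \<Longrightarrow> t * exp (1 / t) \<le> t + (2::real)"
proof -
  assume t: "t \<ge> 1"
  have "exp (1 / t) \<le> 1 + 1 / t + (1 / t)\<^sup>2"
    using t by (intro exp_bound) (auto simp: field_simps)
  also have "(1 / t)\<^sup>2 \<le> 1 / t"
    using t by (simp add: power2_eq_square field_simps)
  finally have "exp (1 / t) \<le> 1 + 2 / t" by simp
  then have "t * exp (1 / t) \<le> t * (1 + 2 / t)"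
    using t by (intro mult_left_mono) auto
  also have "\<dots> = t + 2" using t by (simp add: field_simps)
  finally show ?thesis .
qed

lemma power_le_fact_exp: "x \<ge> 0 \<Longrightarrow> x ^ m \<le> fact m * exp (x::real)"
proof -
  assume x: "x \<ge> 0"
  have "(\<Sum>k\<in>{m}. x ^ k /\<^sub>R fact k) \<le> (\<Sum>k. x ^ k /\<^sub>R fact k)"
    using x by (intro sum_le_suminf sums_summable[OF exp_converges]) auto
  then show ?thesis
    using sums_unique[OF exp_converges[of x]] by (simp add: field_simps)
qed

text \<open>Since \<open>k + j \<le> j * (k + 1)\<close> for \<open>j \<ge> 1\<close>. In Poisson sums this trades a factor \<open>1 / (k + 1) ^ m\<close> for
  a shift of the index of the exponential series by \<open>m\<close>.\<close>
lemma fact_add_le: "(fact (k + m) :: real) \<le> fact m * (real k + 1) ^ m * fact k"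
proof (induction m)
  case (Suc m)
  have "real (k + Suc m) \<le> real (Suc m) * (real k + 1)" by (simp add: algebra_simps)
  then have "(fact (k + Suc m) :: real) \<le> (real (Suc m) * (real k + 1)) * (fact m * (real k + 1) ^ m * fact k)"
    using Suc.IH unfolding add_Suc_right fact_Suc by (intro mult_mono) auto
  then show ?case by (simp add: algebra_simps)
qed simp

text \<open>Bounding \<open>(k / t) ^ m\<close> by \<open>fact m * exp (k / t)\<close> turns the moment into the moment generating function
  of the Poisson distribution at \<open>1 / t\<close>, which is again an exponential series.\<close>
lemma poisson_moment_positive:
  assumes t: "t \<ge> 1"
  shows "summable (\<lambda>k. t ^ k / fact k * (real k / t) ^ m)"
    and "(\<Sum>k. t ^ k / fact k * (real k / t) ^ m) \<le> fact m * exp (t + 2)"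
proof -
  let ?f = "\<lambda>k. t ^ k / fact k * (real k / t) ^ m" and ?g = "\<lambda>k. fact m * ((t * exp (1 / t)) ^ k /\<^sub>R fact k)"
  have le: "0 \<le> ?f k \<and> ?f k \<le> ?g k" for k
  proof -
    have "(real k / t) ^ m \<le> fact m * exp (1 / t) ^ k"
      using power_le_fact_exp[of "real k / t" m] exp_of_nat_mult[of k "1 / t"] t by simp
    then have "t ^ k / fact k * (real k / t) ^ m \<le> t ^ k / fact k * (fact m * exp (1 / t) ^ k)"
      using t by (intro mult_left_mono) auto
    also have "\<dots> = ?g k" by (simp add: power_mult_distrib divide_inverse scaleR_conv_of_real)
    finally show ?thesis using t by simp
  qed
  have g: "?g sums (fact m * exp (t * exp (1 / t)))"
    by (intro sums_mult exp_converges)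
  show s: "summable ?f"
    by (rule summable_comparison_test'[OF sums_summable[OF g]])
       (metis le abs_of_nonneg real_norm_def)
  have "suminf ?f \<le> fact m * exp (t * exp (1 / t))"
    using suminf_le[OF _ s sums_summable[OF g]] le sums_unique[OF g] by metis
  also have "\<dots> \<le> fact m * exp (t + 2)"
    using exp_inverse_le[OF t] by simp
  finally show "suminf ?f \<le> fact m * exp (t + 2)" .
qed

text \<open>By \<open>fact_add_le\<close> the terms are at most \<open>fact m\<close> times those of the exponential series
  with its first \<open>m\<close> terms removed.\<close>
lemma poisson_moment_negative:
  assumes t: "t \<ge> 0"
  shows "summable (\<lambda>k. t ^ k / fact k * (t / (real k + 1)) ^ m)"
    and "(\<Sum>k. t ^ k / fact k * (t / (real k + 1)) ^ m) \<le> fact m * exp t"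
proof -
  let ?f = "\<lambda>k. t ^ k / fact k * (t / (real k + 1)) ^ m" and ?g = "\<lambda>k. t ^ (k + m) /\<^sub>R fact (k + m)"
  have le: "0 \<le> ?f k \<and> ?f k \<le> fact m * ?g k" for k
  proof -
    have "1 / (fact k * (real k + 1) ^ m) \<le> fact m / fact (k + m)"
      using fact_add_le[of k m] by (simp add: field_simps)
    then have "t ^ (k + m) * (1 / (fact k * (real k + 1) ^ m)) \<le> t ^ (k + m) * (fact m / fact (k + m))"
      using t by (intro mult_left_mono) auto
    then show ?thesis using t by (simp add: power_divide power_add field_simps)
  qed
  have s0: "summable (\<lambda>k. t ^ k /\<^sub>R fact k)" using sums_summable[OF exp_converges] .
  have sg: "summable ?g" using s0 by (rule summable_ignore_initial_segment)
  have g: "suminf ?g \<le> exp t"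
    using suminf_minus_initial_segment[OF s0, of m] sum_nonneg[of "{..<m}" "\<lambda>k. t ^ k /\<^sub>R fact k"] t 
      sums_unique[OF exp_converges[of t]] by simp
  show s: "summable ?f"
    by (rule summable_comparison_test'[OF summable_mult[OF sg, of "fact m"]])
       (metis le abs_of_nonneg real_norm_def)
  have "suminf ?f \<le> fact m * suminf ?g"
    using suminf_le[OF _ s summable_mult[OF sg, of "fact m"]] le suminf_mult[OF sg, of "fact m"] by metis
  also have "\<dots> \<le> fact m * exp t" using g by simp
  finally show "suminf ?f \<le> fact m * exp t" .
qed

text \<open>The bound is uniform in all \<open>k\<close>, including the finitely many small ones where \<open>b\<close> is unrelated to \<open>R\<close>:
  there \<open>t / (k + 1)\<close> is comparable to \<open>t\<close> and \<open>R\<close> decays at most like a power. Writing \<open>k + 1\<close> in the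
  denominator keeps the term \<open>k = 0\<close> meaningful.\<close>
lemma regularly_varying_two_sided_power_bound:
  fixes b :: "nat \<Rightarrow> real"
  assumes R: "regularly_varying a \<beta> R" and D: "D \<ge> 0"
    and b: "\<And>k. k \<ge> N \<Longrightarrow> b k \<le> D * R (real k)"
  obtains C X m where "C > 0" "X \<ge> 1" "X \<ge> a"
    "\<And>t k. t \<ge> X \<Longrightarrow> b k \<le> C * R t * ((real k / t) ^ m + (t / (real k + 1)) ^ m)"
proof -
  obtain X0 m where X0: "X0 \<ge> a"
    and up: "\<And>x y. X0 \<le> x \<Longrightarrow> x \<le> y \<Longrightarrow> R y \<le> 2 ^ m * (y / x) ^ m * R x"
    and lo: "\<And>x y. X0 \<le> x \<Longrightarrow> x \<le> y \<Longrightarrow> R x \<le> 2 ^ m * (y / x) ^ m * R y"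
    using regularly_varying_power_bounds[OF R] by blast
  define X where "X = max (max X0 1) (real N)"
  have pos: "R s > 0" if "s \<ge> X" for s using that X0 R by (auto simp: regularly_varying_def X_def)
  have X1: "X \<ge> 1" "X \<ge> X0" by (auto simp: X_def)
  define B where "B = Max (insert 0 (b ` {k. real k < X}))"
  have "finite {k. real k < X}"
    by (rule finite_subset[of _ "{..nat \<lceil>X\<rceil>}"]) (auto, linarith)
  then have B: "B \<ge> 0" "\<And>k. real k < X \<Longrightarrow> b k \<le> B"
    unfolding B_def by (auto intro!: Max_ge)
  define C where "C = 4 ^ m * (D + B / R X + 1)"
  have RX: "R X > 0" by (rule pos) simp
  have C: "4 ^ m * D \<le> C" "4 ^ m * (B / R X) \<le> C" "C > 0"
    using B D RX by (auto simp: C_def algebra_simps add_pos_nonneg intro!: add_nonneg_pos)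
  have "b k \<le> C * R t * ((real k / t) ^ m + (t / (real k + 1)) ^ m)" if t: "t \<ge> X" for t k
  proof -
    have Rt: "R t > 0" "t > 0" using pos t X1 by auto
    consider "real k \<ge> X" "real k \<ge> t" | "real k \<ge> X" "real k \<le> t" | "real k < X" by linarith
    then show ?thesis
    proof cases
      case 1
      have "b k \<le> D * R (real k)" using 1 b by (simp add: X_def)
      also have "\<dots> \<le> D * (2 ^ m * (real k / t) ^ m * R t)"
        using up[of t "real k"] 1 t X1 D by (intro mult_left_mono) auto
      also have "\<dots> \<le> D * (4 ^ m * (real k / t) ^ m * R t)"
        using Rt D by (intro mult_left_mono mult_right_mono power_mono) auto
      also have "\<dots> = (4 ^ m * D) * (R t * (real k / t) ^ m)" by simp
      also have "\<dots> \<le> C * (R t * ((real k / t) ^ m + (t / (real k + 1)) ^ m))"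
        using C Rt D by (intro mult_mono) auto
      finally show ?thesis by (simp add: mult.assoc)
    next
      case 2
      have k: "real k \<ge> 1" using 2 X1 by linarith
      have "b k \<le> D * R (real k)" using 2 b by (simp add: X_def)
      also have "\<dots> \<le> D * (2 ^ m * (t / real k) ^ m * R t)"
        using lo[of "real k" t] 2 t X1 D by (intro mult_left_mono) auto
      also have "2 ^ m * (t / real k) ^ m = (2 * (t / real k)) ^ m"
        by (simp only: power_mult_distrib)
      also have "\<dots> \<le> (4 * (t / (real k + 1))) ^ m"
        using k Rt by (intro power_mono) (auto simp: field_simps)
      also have "\<dots> = 4 ^ m * (t / (real k + 1)) ^ m" by (simp only: power_mult_distrib)
      also have "D * (4 ^ m * (t / (real k + 1)) ^ m * R t) = (4 ^ m * D) * (R t * (t / (real k + 1)) ^ m)" by simp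
      also have "\<dots> \<le> C * (R t * ((real k / t) ^ m + (t / (real k + 1)) ^ m))"
        using C Rt D by (intro mult_mono) auto
      finally show ?thesis using Rt D by (simp add: mult.assoc mult_left_mono mult_right_mono)
    next
      case 3
      have "b k \<le> B / R X * R X" using 3 B RX by simp
      also have "\<dots> \<le> B / R X * (2 ^ m * (t / X) ^ m * R t)"
        using lo[of X t] t X1 B RX by (intro mult_left_mono) auto
      also have "\<dots> \<le> B / R X * (4 ^ m * (t / (real k + 1)) ^ m * R t)"
      proof -
        have "(2 * (t / X)) ^ m \<le> (4 * (t / (real k + 1))) ^ m"
          using 3 Rt X1 mult_left_mono[of "real k + 1" "2 * X" "2 * t"]
          by (intro power_mono) (auto simp: field_simps)
        then show ?thesis using B RX Rt 
          by (intro mult_left_mono mult_right_mono) (auto simp only: power_mult_distrib less_imp_le zero_le_divide_iff)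
      qed
      also have "\<dots> = (4 ^ m * (B / R X)) * (R t * (t / (real k + 1)) ^ m)" by simp
      also have "\<dots> \<le> C * (R t * ((real k / t) ^ m + (t / (real k + 1)) ^ m))"
        using C Rt B RX by (intro mult_mono) auto
      finally show ?thesis by (simp add: mult.assoc)
    qed
  qed
  then show ?thesis using that[of C X m] C X1 X0 by auto
qed

lemma poisson_average_regularly_varying:
  fixes b :: "nat \<Rightarrow> real"
  assumes R: "regularly_varying a \<beta> R" and D: "D \<ge> 0"
    and b0: "\<And>k. b k \<ge> 0"
    and b: "\<And>k. k \<ge> N \<Longrightarrow> b k \<le> D * R (real k)"
  obtains C X where "C > 0" "X > 0" "X \<ge> a"
    "\<And>t. t \<ge> X \<Longrightarrow> summable (\<lambda>k. t ^ k / fact k * b k)"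
    "\<And>t. t \<ge> X \<Longrightarrow> exp (- t) * (\<Sum>k. t ^ k / fact k * b k) \<le> C * R t"
proof -
  obtain C X m where C: "C > 0" and X: "X \<ge> 1" "X \<ge> a"
    and le: "\<And>t k. t \<ge> X \<Longrightarrow> b k \<le> C * R t * ((real k / t) ^ m + (t / (real k + 1)) ^ m)"
    using regularly_varying_two_sided_power_bound[OF R D b] by blast
  define C' where "C' = C * fact m * (exp 2 + 1)"
  have main: "summable (\<lambda>k. t ^ k / fact k * b k) \<and> exp (- t) * (\<Sum>k. t ^ k / fact k * b k) \<le> C' * R t"
    if t: "t \<ge> X" for t
  proof -
    have t1: "t \<ge> 1" and Rt: "R t > 0" using t X R by (auto simp: regularly_varying_def)
    let ?p = "\<lambda>k. t ^ k / fact k * (real k / t) ^ m" and ?q = "\<lambda>k. t ^ k / fact k * (t / (real k + 1)) ^ m"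
    have p: "summable ?p" "suminf ?p \<le> fact m * exp (t + 2)"
      using poisson_moment_positive[OF t1] by auto
    have q: "summable ?q" "suminf ?q \<le> fact m * exp t"
      using poisson_moment_negative[of t m] t1 by auto
    have le': "t ^ k / fact k * b k \<le> C * R t * (?p k + ?q k)" for k
    proof -
      have "t ^ k / fact k * b k \<le> t ^ k / fact k * (C * R t * ((real k / t) ^ m + (t / (real k + 1)) ^ m))"
        using le[OF t] t1 by (intro mult_left_mono) auto
      then show ?thesis by (simp only: algebra_simps)
    qed
    have spq: "summable (\<lambda>k. C * R t * (?p k + ?q k))"
      using p q by (intro summable_mult summable_add)
    have s: "summable (\<lambda>k. t ^ k / fact k * b k)"
      by (rule summable_comparison_test'[OF spq]) (use le' b0 t1 in auto)
    have "(\<Sum>k. t ^ k / fact k * b k) \<le> (\<Sum>k. C * R t * (?p k + ?q k))"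
      by (rule suminf_le[OF le' s spq])
    also have "\<dots> = C * R t * (suminf ?p + suminf ?q)"
      using p q by (simp only: suminf_mult suminf_add summable_add)
    also have "\<dots> \<le> C * R t * (fact m * exp (t + 2) + fact m * exp t)"
      using p q C Rt by (intro mult_left_mono add_mono) auto
    also have "\<dots> = exp t * (C' * R t)"
      by (simp add: C'_def exp_add algebra_simps)
    finally have "exp (- t) * (\<Sum>k. t ^ k / fact k * b k) \<le> exp (- t) * (exp t * (C' * R t))"
      by (intro mult_left_mono) auto
    also have "\<dots> = C' * R t" by (simp add: exp_minus)
    finally show ?thesis using s by simp
  qed
  have "C' > 0" using C by (simp add: C'_def add_pos_pos)
  then show ?thesis using that[of C' X] main X by auto
qed

section \<open>Minkowski's inequality for series\<close>

text \<open>Extends \<open>powr_convex\<close> to the endpoint 0, where the functions below may vanish.\<close>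
lemma convex_on_powr_nonneg:
  assumes "q \<ge> 1"
  shows "convex_on {0::real..} (\<lambda>x. x powr q)"
proof (rule convex_onI)
  fix t x y :: real
  assume t: "0 < t" "t < 1" and xy: "x \<in> {0..}" "y \<in> {0..}"
  have le: "s powr q \<le> s" if "0 \<le> s" "s \<le> 1" for s :: real
    using powr_mono_both'[of 1 q s s] that assms by (cases "s = 0") auto
  consider "x = 0" | "y = 0" | "x > 0" "y > 0" using xy by fastforce
  then show "((1 - t) *\<^sub>R x + t *\<^sub>R y) powr q \<le> (1 - t) * x powr q + t * y powr q"
  proof cases
    case 1
    then show ?thesis using t xy le[of t] assms by (simp add: powr_mult mult_right_mono)
  next
    case 2
    then show ?thesis using t xy le[of "1 - t"] assms by (simp add: powr_mult mult_right_mono)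
  next
    case 3
    then show ?thesis
      using convex_onD[OF powr_convex[OF assms], of t x y] t by simp
  qed
qed simp

text \<open>Jensen's inequality for \<open>x powr q\<close> with weights \<open>w k * b k / S\<close> at the points \<open>g k / b k\<close>. When \<open>b k\<close> bounds the
  \<open>q\<close>-norm of \<open>g k\<close>, integrating the right-hand side gives at most \<open>S powr q\<close>.\<close>
lemma weighted_sum_powr_le:
  fixes w b g :: "nat \<Rightarrow> real"
  assumes q: "q \<ge> 1" and w: "\<And>k. w k > 0" and b: "\<And>k. b k > 0" and g: "\<And>k. g k \<ge> 0"
    and n: "n > 0"
  defines "S \<equiv> (\<Sum>k<n. w k * b k)"
  shows "(\<Sum>k<n. w k * g k) powr q \<le> (\<Sum>k<n. S powr q * (w k * b k / S) / b k powr q * g k powr q)"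
proof -
  have S: "S > 0" unfolding S_def using n w b by (intro sum_pos) auto
  let ?a = "\<lambda>k. w k * b k / S"
  have "(\<Sum>k<n. w k * g k) = S * (\<Sum>k<n. ?a k *\<^sub>R (g k / b k))"
    using S b by (auto simp: sum_distrib_left less_imp_neq[symmetric] field_simps intro!: sum.cong)
  then have "(\<Sum>k<n. w k * g k) powr q = S powr q * (\<Sum>k<n. ?a k *\<^sub>R (g k / b k)) powr q"
    using S b w g by (simp add: powr_mult sum_nonneg less_imp_le)
  also have "\<dots> \<le> S powr q * (\<Sum>k<n. ?a k * (g k / b k) powr q)"
  proof (intro mult_left_mono convex_on_sum[OF _ _ convex_on_powr_nonneg[OF q]])
    show "(\<Sum>k<n. ?a k) = 1" using S by (simp add: S_def flip: sum_divide_distrib)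
  qed (use n S w b g in \<open>auto simp: less_imp_le zero_le_divide_iff zero_le_mult_iff\<close>)
  also have "\<dots> = (\<Sum>k<n. S powr q * ?a k / b k powr q * g k powr q)"
    using b g by (simp add: sum_distrib_left powr_divide less_imp_le mult_ac)
  finally show ?thesis .
qed

text \<open>The partial sums satisfy the inequality by \<open>weighted_sum_powr_le\<close>. They increase, so their \<open>q\<close>-th powers
  have a supremum with finite integral; that supremum is finite almost everywhere, which is the convergence
  of the series.\<close>
lemma minkowski_series:
  fixes g :: "nat \<Rightarrow> 'a \<Rightarrow> real"
  assumes q: "q \<ge> 1"
    and g: "\<And>k. g k \<in> borel_measurable M" "\<And>k x. g k x \<ge> 0"
    and w: "\<And>k. w k > 0" and b: "\<And>k. b k > 0"
    and le: "\<And>k. (\<integral>\<^sup>+x. ennreal (g k x powr q) \<partial>M) \<le> ennreal (b k powr q)"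
    and S: "summable (\<lambda>k. w k * b k)"
  shows "AE x in M. summable (\<lambda>k. w k * g k x)"
    and "(\<integral>\<^sup>+x. ennreal ((\<Sum>k. w k * g k x) powr q) \<partial>M) \<le> ennreal ((\<Sum>k. w k * b k) powr q)"
proof -
  note [measurable] = g(1)
  define T where "T = (\<Sum>k. w k * b k)"
  define F where "F n x = (\<Sum>k<n. w k * g k x) powr q" for n x
  have [measurable]: "F n \<in> borel_measurable M" for n unfolding F_def by measurable
  have partial: "(\<integral>\<^sup>+x. ennreal (F n x) \<partial>M) \<le> ennreal (T powr q)" for n
  proof (cases "n = 0")
    case False
    define Sn where "Sn = (\<Sum>k<n. w k * b k)"
    have Sn: "Sn > 0" unfolding Sn_def using False w b by (intro sum_pos) auto
    have SnT: "Sn \<le> T" unfolding Sn_def T_def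
      using S w b by (intro sum_le_suminf) (auto intro: mult_nonneg_nonneg less_imp_le)
    define c where "c k = Sn powr q * (w k * b k / Sn) / b k powr q" for k
    have c: "c k \<ge> 0" for k using Sn w[of k] b[of k] by (simp add: c_def)
    have "(\<integral>\<^sup>+x. ennreal (F n x) \<partial>M) \<le> (\<integral>\<^sup>+x. (\<Sum>k<n. ennreal (c k) * ennreal (g k x powr q)) \<partial>M)"
    proof (rule nn_integral_mono)
      fix x
      have "F n x \<le> (\<Sum>k<n. c k * g k x powr q)"
        unfolding F_def c_def Sn_def using q w b g(2) False by (intro weighted_sum_powr_le) auto
      then show "ennreal (F n x) \<le> (\<Sum>k<n. ennreal (c k) * ennreal (g k x powr q))"
        using c by (simp add: ennreal_leI flip: ennreal_mult)
    qed
    also have "\<dots> = (\<Sum>k<n. ennreal (c k) * (\<integral>\<^sup>+x. ennreal (g k x powr q) \<partial>M))"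
      by (simp add: nn_integral_sum nn_integral_cmult)
    also have "\<dots> \<le> (\<Sum>k<n. ennreal (c k) * ennreal (b k powr q))"
      using le by (intro sum_mono mult_left_mono) auto
    also have "\<dots> = ennreal (\<Sum>k<n. c k * b k powr q)"
      using c by (simp flip: ennreal_mult)
    also have "(\<Sum>k<n. c k * b k powr q) = (\<Sum>k<n. Sn powr q * (w k * b k / Sn))"
      using b by (intro sum.cong) (auto simp: c_def less_imp_neq[symmetric])
    also have "\<dots> = Sn powr q"
      using Sn by (simp add: Sn_def flip: sum_distrib_left sum_divide_distrib)
    also have "ennreal \<dots> \<le> ennreal (T powr q)"
      using Sn SnT q by (intro ennreal_leI powr_mono2) auto
    finally show ?thesis .
  qed (simp add: F_def)
  have mono: "F m x \<le> F n x" if "m \<le> n" for m n x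
    unfolding F_def using that q g(2) w
    by (intro powr_mono2 sum_mono2 sum_nonneg mult_nonneg_nonneg) (auto intro: less_imp_le)
  then have inc: "incseq (\<lambda>n x. ennreal (F n x))"
    by (auto simp: incseq_def le_fun_def intro: ennreal_leI)
  have sup: "(\<integral>\<^sup>+x. (SUP n. ennreal (F n x)) \<partial>M) \<le> ennreal (T powr q)"
    using partial by (subst nn_integral_monotone_convergence_SUP[OF inc]) (auto intro: SUP_least)
  then have "(\<integral>\<^sup>+x. (SUP n. ennreal (F n x)) \<partial>M) \<noteq> \<infinity>"
    by (metis ennreal_less_top infinity_ennreal_def leD)
  then have fin: "AE x in M. (SUP n. ennreal (F n x)) \<noteq> \<infinity>"
    by (intro nn_integral_noteq_infinite) auto
  have key: "summable (\<lambda>k. w k * g k x) \<and> ennreal ((\<Sum>k. w k * g k x) powr q) \<le> (SUP n. ennreal (F n x))"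
    if x: "(SUP n. ennreal (F n x)) \<noteq> \<infinity>" for x
  proof -
    obtain c where c: "c \<ge> 0" "(SUP n. ennreal (F n x)) = ennreal c"
      using x by (cases "SUP n. ennreal (F n x)") auto
    have "ennreal (F n x) \<le> ennreal c" for n
      unfolding c(2)[symmetric] by (intro SUP_upper) simp
    then have Fc: "F n x \<le> c" for n using c by simp
    have nn: "(\<Sum>k<n. w k * g k x) \<ge> 0" for n
      using w g(2) by (intro sum_nonneg mult_nonneg_nonneg) (auto intro: less_imp_le)
    have "(\<Sum>k<n. w k * g k x) \<le> c powr (1 / q)" for n
    proof -
      have "(\<Sum>k<n. w k * g k x) = F n x powr (1 / q)"
        using nn[of n] q by (simp add: F_def powr_powr)
      also have "\<dots> \<le> c powr (1 / q)"
        using Fc[of n] q by (intro powr_mono2) (auto simp: F_def)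
      finally show ?thesis .
    qed
    then have s: "summable (\<lambda>k. w k * g k x)"
      using w g(2) by (intro summableI_nonneg_bounded) (auto simp: less_imp_le)
    have "(\<lambda>n. F n x) \<longlonglongrightarrow> (\<Sum>k. w k * g k x) powr q"
      unfolding F_def using summable_LIMSEQ[OF s] nn q by (intro tendsto_powr' tendsto_const) auto
    then have "(\<Sum>k. w k * g k x) powr q \<le> c"
      using Fc by (intro LIMSEQ_le_const2) auto
    then show ?thesis using s c by (simp add: ennreal_leI)
  qed
  show "AE x in M. summable (\<lambda>k. w k * g k x)"
    using fin key by auto
  have "(\<integral>\<^sup>+x. ennreal ((\<Sum>k. w k * g k x) powr q) \<partial>M) \<le> (\<integral>\<^sup>+x. (SUP n. ennreal (F n x)) \<partial>M)"
    using fin key by (intro nn_integral_mono_AE) auto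
  also note sup
  finally show "(\<integral>\<^sup>+x. ennreal ((\<Sum>k. w k * g k x) powr q) \<partial>M) \<le> ennreal ((\<Sum>k. w k * b k) powr q)"
    by (simp add: T_def)
qed

lemma Lp_norm_le_iff:
  assumes p: "p \<ge> 1" "p \<noteq> \<infinity>" and b: "b \<ge> 0"
  shows "Lp_norm p f \<le> ennreal b \<longleftrightarrow>
    (\<integral>\<^sup>+ x. ennreal (norm (f x) powr enn2real p) \<partial>lebesgue) \<le> ennreal (b powr enn2real p)"
proof -
  define q where "q = enn2real p"
  have q: "q > 0" using p unfolding q_def by (cases p) auto
  let ?I = "\<integral>\<^sup>+ x. ennreal (norm (f x) powr q) \<partial>lebesgue"
  show ?thesis
  proof (cases ?I)
    case (real r)
    have "r powr (1 / q) \<le> b \<longleftrightarrow> r \<le> b powr q"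
    proof
      assume "r powr (1 / q) \<le> b"
      then have "(r powr (1 / q)) powr q \<le> b powr q" using q by (intro powr_mono2) auto
      then show "r \<le> b powr q" using real q by (simp add: powr_powr)
    next
      assume "r \<le> b powr q"
      then have "r powr (1 / q) \<le> (b powr q) powr (1 / q)" using real q by (intro powr_mono2) auto
      then show "r powr (1 / q) \<le> b" using b q by (simp add: powr_powr)
    qed
    then show ?thesis using real p b by (simp add: Lp_norm_def Let_def flip: q_def)
  next
    case top
    then show ?thesis using p by (simp add: Lp_norm_def Let_def top_unique flip: q_def)
  qed
qed

lemma Lp_norm_infinity_le_iff:
  assumes "f \<in> borel_measurable lebesgue" "b \<ge> 0"
  shows "Lp_norm \<infinity> f \<le> ennreal b \<longleftrightarrow> (AE x in lebesgue. norm (f x) \<le> b)"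
proof
  assume "Lp_norm \<infinity> f \<le> ennreal b"
  then have le: "esssup lebesgue (\<lambda>x. ennreal (norm (f x))) \<le> ennreal b" by (simp add: Lp_norm_def)
  show "AE x in lebesgue. norm (f x) \<le> b"
    using esssup_AE[of "\<lambda>x. ennreal (norm (f x))" lebesgue]
  proof eventually_elim
    case (elim x)
    then have "ennreal (norm (f x)) \<le> ennreal b" using le by (rule order_trans)
    then show ?case using assms by simp
  qed
next
  assume "AE x in lebesgue. norm (f x) \<le> b"
  then show "Lp_norm \<infinity> f \<le> ennreal b"
    using assms unfolding Lp_norm_def by (auto intro!: esssup_I ennreal_leI)
qed

text \<open>A divergent complex series has an arbitrary value, so the pointwise triangle inequality is available only
  where the series converges absolutely; this is almost everywhere, by \<open>minkowski_series\<close> if \<open>p\<close> is finite and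
  directly otherwise. The outer factor \<open>c\<close> is absorbed in the weights.\<close>
lemma Lp_norm_series_le:
  fixes f :: "nat \<Rightarrow> 'a::euclidean_space \<Rightarrow> complex"
  assumes p: "p \<ge> 1"
    and f: "\<And>k. f k \<in> borel_measurable lebesgue"
    and le: "\<And>k. Lp_norm p (f k) \<le> ennreal (b k)"
    and b: "\<And>k. b k > 0" and w: "\<And>k. w k > 0" and c: "c > 0"
    and S: "summable (\<lambda>k. w k * b k)"
  shows "Lp_norm p (\<lambda>x. of_real c * (\<Sum>k. of_real (w k) * f k x)) \<le> ennreal (c * (\<Sum>k. w k * b k))"
proof -
  note [measurable] = f
  let ?h = "\<lambda>x. of_real c * (\<Sum>k. of_real (w k) * f k x)"
  have cw: "c * w k > 0" for k using c w by simp
  have cS: "summable (\<lambda>k. (c * w k) * b k)" "(\<Sum>k. (c * w k) * b k) = c * (\<Sum>k. w k * b k)"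
    using S by (simp_all add: mult.assoc summable_mult suminf_mult)
  have nonneg: "0 \<le> c * (\<Sum>k. w k * b k)"
    using S b w c by (intro mult_nonneg_nonneg suminf_nonneg) (auto intro: less_imp_le)
  have pointwise: "norm (?h x) \<le> (\<Sum>k. (c * w k) * norm (f k x))"
    if s: "summable (\<lambda>k. (c * w k) * norm (f k x))" for x
  proof -
    have "summable (\<lambda>k. inverse c * ((c * w k) * norm (f k x)))"
      using s by (rule summable_mult)
    moreover have "inverse c * ((c * w k) * norm (f k x)) = w k * norm (f k x)" for k
      using c by (simp add: field_simps)
    ultimately have s': "summable (\<lambda>k. w k * norm (f k x))" by simp
    have "norm (\<Sum>k. of_real (w k) * f k x) \<le> (\<Sum>k. norm (of_real (w k) * f k x))"
      using s' w by (intro summable_norm) (simp add: norm_mult less_imp_le)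
    also have "\<dots> = (\<Sum>k. w k * norm (f k x))" using w by (simp add: norm_mult less_imp_le)
    finally have "norm (?h x) \<le> c * (\<Sum>k. w k * norm (f k x))" using c by (simp add: norm_mult)
    then show ?thesis using suminf_mult[OF s', of c] by (simp add: mult.assoc)
  qed
  show ?thesis
  proof (cases "p = \<infinity>")
    case True
    have "AE x in lebesgue. \<forall>k. norm (f k x) \<le> b k"
      unfolding AE_all_countable using le f b True Lp_norm_infinity_le_iff[OF f less_imp_le[OF b]] by simp
    then have "AE x in lebesgue. norm (?h x) \<le> c * (\<Sum>k. w k * b k)"
    proof eventually_elim
      case (elim x)
      have t: "(c * w k) * norm (f k x) \<le> (c * w k) * b k" for k
        using elim less_imp_le[OF cw[of k]] by (intro mult_left_mono) auto
      have "norm ((c * w k) * norm (f k x)) \<le> (c * w k) * b k" for k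
        using t[of k] less_imp_le[OF cw[of k]] by (metis abs_of_nonneg mult_nonneg_nonneg norm_ge_zero real_norm_def)
      then have s: "summable (\<lambda>k. (c * w k) * norm (f k x))"
        by (rule summable_comparison_test'[OF cS(1)])
      have "(\<Sum>k. (c * w k) * norm (f k x)) \<le> (\<Sum>k. (c * w k) * b k)"
        by (rule suminf_le[OF t s cS(1)])
      then show ?case using pointwise[OF s] cS(2) by simp
    qed
    then show ?thesis unfolding True using nonneg by (subst Lp_norm_infinity_le_iff) auto
  next
    case False
    define q where "q = enn2real p"
    have q: "q \<ge> 1" using p False unfolding q_def by (cases p) auto
    have lek: "(\<integral>\<^sup>+x. ennreal (norm (f k x) powr q) \<partial>lebesgue) \<le> ennreal (b k powr q)" for k
      using le[of k] unfolding Lp_norm_le_iff[OF p False less_imp_le[OF b]] q_def .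
    note mink = minkowski_series[where g = "\<lambda>k x. norm (f k x)" and M = lebesgue, OF q _ _ cw b lek cS(1)]
    have "(\<integral>\<^sup>+x. ennreal (norm (?h x) powr q) \<partial>lebesgue)
        \<le> (\<integral>\<^sup>+x. ennreal ((\<Sum>k. (c * w k) * norm (f k x)) powr q) \<partial>lebesgue)"
    proof (rule nn_integral_mono_AE)
      have "AE x in lebesgue. summable (\<lambda>k. (c * w k) * norm (f k x))" by (rule mink(1)) auto
      then show "AE x in lebesgue. ennreal (norm (?h x) powr q) \<le> ennreal ((\<Sum>k. (c * w k) * norm (f k x)) powr q)"
      proof eventually_elim
        case (elim x)
        show ?case using pointwise[OF elim] q by (intro ennreal_leI powr_mono2) auto
      qed
    qed
    also have "\<dots> \<le> ennreal ((\<Sum>k. (c * w k) * b k) powr q)" by (rule mink(2)) auto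
    finally show ?thesis
      using Lp_norm_le_iff[OF p False nonneg] unfolding cS(2) q_def by blast
  qed
qed

section \<open>Iterated kernels\<close>

lemma sigma_finite_lebesgue: "sigma_finite_measure (lebesgue :: 'a::euclidean_space measure)"
proof -
  obtain A :: "'a set set" where A: "countable A \<and> A \<subseteq> sets lborel \<and> \<Union>A = space lborel
      \<and> (\<forall>a\<in>A. emeasure lborel a \<noteq> \<infinity>)"
    using lborel.sigma_finite_countable ..
  show ?thesis
  proof (rule sigma_finite_measure.intro, intro exI[of _ A] conjI)
    show "\<forall>a\<in>A. emeasure lebesgue a \<noteq> \<infinity>"
      using A by (auto simp: subset_eq)
  qed (use A in auto)
qed

lemma ennreal_norm_integral_le:
  fixes f :: "'a \<Rightarrow> 'b::{banach, second_countable_topology}"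
  shows "ennreal (norm (integral\<^sup>L M f)) \<le> (\<integral>\<^sup>+x. ennreal (norm (f x)) \<partial>M)"
  by (cases "integrable M f") (auto intro: integral_norm_bound_ennreal simp: not_integrable_integral_eq)

lemma integral_op_measurable:
  assumes J: "(\<lambda>(x, y). J x y) \<in> borel_measurable (lebesgue \<Otimes>\<^sub>M lebesgue)"
    and u[measurable]: "u \<in> borel_measurable lebesgue"
  shows "integral_op J u \<in> borel_measurable lebesgue"
proof -
  interpret sigma_finite_measure "lebesgue :: 'a measure" by (rule sigma_finite_lebesgue)
  note J[measurable]
  show ?thesis unfolding integral_op_def[abs_def] by measurable
qed

lemma integral_op_funpow_measurable:
  assumes "(\<lambda>(x, y). J x y) \<in> borel_measurable (lebesgue \<Otimes>\<^sub>M lebesgue)"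
    and "u \<in> borel_measurable lebesgue"
  shows "(integral_op J ^^ k) u \<in> borel_measurable lebesgue"
  by (induction k) (simp_all add: assms integral_op_measurable)

text \<open>The product of \<open>J\<close> along the path from \<open>x\<close> through \<open>z 1, \<dots>, z k\<close>. Leaving the end point \<open>z k\<close> among
  the coordinates gives both recursions from one function: integrating over \<open>z k\<close> first applies the
  operator once more, integrating over it last leaves the iterated kernel.\<close>
definition path_weight ::
  "('a::euclidean_space \<Rightarrow> 'a \<Rightarrow> complex) \<Rightarrow> nat \<Rightarrow> 'a \<Rightarrow> (nat \<Rightarrow> 'a) \<Rightarrow> complex" where
  "path_weight J k x z = (\<Prod>i<k. J ((z(0 := x)) i) (z (Suc i)))"

lemma path_weight_Suc_update:
  "path_weight J (Suc k) x (z(Suc k := y)) = path_weight J k x z * J ((z(0 := x)) k) y"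
proof -
  have "(\<Prod>i<k. J (((z(Suc k := y))(0 := x)) i) ((z(Suc k := y)) (Suc i))) = (\<Prod>i<k. J ((z(0 := x)) i) (z (Suc i)))"
    by (intro prod.cong) auto
  then show ?thesis by (simp add: path_weight_def)
qed

lemma iter_kernel_eq_path_weight:
  assumes "k > 0"
  shows "iter_kernel J k x y = (\<integral>z. path_weight J k x (z(k := y)) \<partial>(Pi\<^sub>M {1..<k} (\<lambda>_. lebesgue)))"
  using assms unfolding iter_kernel_def path_weight_def
  by (intro Bochner_Integration.integral_cong prod.cong) auto

locale bounded_kernel =
  fixes J :: "'a::euclidean_space \<Rightarrow> 'a \<Rightarrow> complex" and M :: ennreal
  assumes J_measurable: "(\<lambda>(x, y). J x y) \<in> borel_measurable (lebesgue \<Otimes>\<^sub>M lebesgue)"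
    and J_bound: "\<And>x. (\<integral>\<^sup>+ y. ennreal (norm (J x y)) \<partial>lebesgue) \<le> M"
    and M_finite: "M < \<infinity>"
begin

sublocale lebesgue: sigma_finite_measure "lebesgue :: 'a measure"
  by (rule sigma_finite_lebesgue)

sublocale product_sigma_finite "\<lambda>_::nat. lebesgue :: 'a measure"
  by standard

abbreviation points :: "nat \<Rightarrow> (nat \<Rightarrow> 'a) measure" where
  "points k \<equiv> Pi\<^sub>M {1..<Suc k} (\<lambda>_. lebesgue)"

lemma path_interval: "{1..<Suc (Suc k)} = insert (Suc k) {1..<Suc k}"
  by auto

lemma point_measurable:
  assumes "j \<le> k"
  shows "(\<lambda>z. (z(0 := x)) j) \<in> points k \<rightarrow>\<^sub>M lebesgue"
proof (cases "j = 0")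
  case True
  then show ?thesis by simp
next
  case False
  then have "(\<lambda>z. z j) \<in> points k \<rightarrow>\<^sub>M lebesgue"
    using assms by (intro measurable_component_singleton) auto
  then show ?thesis using False by simp
qed

lemma path_weight_measurable: "path_weight J k x \<in> borel_measurable (points k)"
  unfolding path_weight_def[abs_def]
proof (rule borel_measurable_prod)
  fix i assume i: "i \<in> {..<k}"
  have "(\<lambda>z. ((z(0 := x)) i, (z(0 := x)) (Suc i))) \<in> points k \<rightarrow>\<^sub>M lebesgue \<Otimes>\<^sub>M lebesgue"
    using i by (intro measurable_Pair point_measurable) auto
  from measurable_compose[OF this J_measurable]
  show "(\<lambda>z. J ((z(0 := x)) i) (z (Suc i))) \<in> borel_measurable (points k)" by simp
qed

lemma section_measurable: "J x \<in> borel_measurable lebesgue"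
  using measurable_compose[OF measurable_Pair1'[of x lebesgue lebesgue] J_measurable] by simp

lemma nn_integral_J_le:
  assumes C: "AE y in lebesgue. ennreal (norm (u y)) \<le> C"
  shows "(\<integral>\<^sup>+ y. ennreal (norm (J x y * u y)) \<partial>lebesgue) \<le> M * C"
proof -
  note [measurable] = section_measurable
  have "(\<integral>\<^sup>+ y. ennreal (norm (J x y * u y)) \<partial>lebesgue) \<le> (\<integral>\<^sup>+ y. ennreal (norm (J x y)) * C \<partial>lebesgue)"
    using C by (intro nn_integral_mono_AE) (auto simp: norm_mult ennreal_mult intro: mult_left_mono elim!: eventually_mono)
  also have "\<dots> \<le> M * C"
    using J_bound[of x] by (simp add: nn_integral_multc mult_right_mono)
  finally show ?thesis .
qed

lemma integral_op_bounded:
  assumes C: "AE y in lebesgue. ennreal (norm (u y)) \<le> C"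
  shows "ennreal (norm (integral_op J u x)) \<le> M * C"
  using order_trans[OF ennreal_norm_integral_le nn_integral_J_le[OF C]] by (simp add: integral_op_def)

lemma integral_op_funpow_bounded:
  assumes C: "AE y in lebesgue. ennreal (norm (u y)) \<le> C"
  shows "AE x in lebesgue. ennreal (norm ((integral_op J ^^ k) u x)) \<le> M ^ k * C"
proof (induction k)
  case 0
  then show ?case using C by simp
next
  case (Suc k)
  then show ?case using integral_op_bounded[OF Suc] by (simp add: mult.assoc)
qed

lemma path_integrand_measurable:
  assumes "u \<in> borel_measurable lebesgue"
  shows "(\<lambda>z. path_weight J k x z * u ((z(0 := x)) k)) \<in> borel_measurable (points k)"
  using path_weight_measurable measurable_compose[OF point_measurable[OF order_refl] assms]
  by (intro borel_measurable_times) auto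

lemma nn_integral_path_Suc:
  assumes u: "u \<in> borel_measurable lebesgue"
  shows "(\<integral>\<^sup>+ z. ennreal (norm (path_weight J (Suc k) x z * u (z (Suc k)))) \<partial>points (Suc k))
    = (\<integral>\<^sup>+ z. ennreal (norm (path_weight J k x z)) *
         (\<integral>\<^sup>+ y. ennreal (norm (J ((z(0 := x)) k) y * u y)) \<partial>lebesgue) \<partial>points k)"
proof -
  have "(\<lambda>z. ennreal (norm (path_weight J (Suc k) x z * u (z (Suc k))))) \<in> borel_measurable (points (Suc k))"
    using path_integrand_measurable[OF u, of "Suc k" x] by simp
  then have "(\<integral>\<^sup>+ z. ennreal (norm (path_weight J (Suc k) x z * u (z (Suc k)))) \<partial>points (Suc k))
    = (\<integral>\<^sup>+ z. (\<integral>\<^sup>+ y. ennreal (norm (path_weight J (Suc k) x (z(Suc k := y)) * u y)) \<partial>lebesgue) \<partial>points k)"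
    unfolding path_interval by (subst product_nn_integral_insert) auto
  also have "\<dots> = (\<integral>\<^sup>+ z. (\<integral>\<^sup>+ y. ennreal (norm (path_weight J k x z)) * ennreal (norm (J ((z(0 := x)) k) y * u y)) \<partial>lebesgue) \<partial>points k)"
    by (simp only: path_weight_Suc_update norm_mult mult.assoc ennreal_mult[OF norm_ge_zero] norm_ge_zero mult_nonneg_nonneg)
  also have "\<dots> = (\<integral>\<^sup>+ z. ennreal (norm (path_weight J k x z)) *
         (\<integral>\<^sup>+ y. ennreal (norm (J ((z(0 := x)) k) y * u y)) \<partial>lebesgue) \<partial>points k)"
    using section_measurable u by (intro nn_integral_cong nn_integral_cmult) auto
  finally show ?thesis .
qed

text \<open>Integrating out the last point of the path costs a factor of at most \<open>M\<close>.\<close>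
lemma nn_integral_path_weight_le:
  "(\<integral>\<^sup>+ z. ennreal (norm (path_weight J k x z)) \<partial>points k) \<le> M ^ k"
proof (induction k)
  case 0
  then show ?case by (simp add: PiM_empty path_weight_def nn_integral_count_space_finite)
next
  case (Suc k)
  have "(\<integral>\<^sup>+ z. ennreal (norm (path_weight J (Suc k) x z)) \<partial>points (Suc k))
    = (\<integral>\<^sup>+ z. ennreal (norm (path_weight J k x z)) *
         (\<integral>\<^sup>+ y. ennreal (norm (J ((z(0 := x)) k) y)) \<partial>lebesgue) \<partial>points k)"
    using nn_integral_path_Suc[of "\<lambda>_. 1" k x] by simp
  also have "\<dots> \<le> (\<integral>\<^sup>+ z. ennreal (norm (path_weight J k x z)) * M \<partial>points k)"
    by (intro nn_integral_mono mult_left_mono J_bound) simp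
  also have "\<dots> \<le> M ^ k * M"
    using path_weight_measurable[of k x] Suc by (simp add: nn_integral_multc mult_right_mono)
  finally show ?case by (simp add: mult.commute)
qed

lemma path_integrand_integrable:
  assumes u: "u \<in> borel_measurable lebesgue" and C: "C < \<infinity>" "AE y in lebesgue. ennreal (norm (u y)) \<le> C"
  shows "integrable (points (Suc k)) (\<lambda>z. path_weight J (Suc k) x z * u (z (Suc k)))"
proof (rule integrableI_bounded)
  show "(\<lambda>z. path_weight J (Suc k) x z * u (z (Suc k))) \<in> borel_measurable (points (Suc k))"
    using path_integrand_measurable[OF u, of "Suc k" x] by simp
  have "(\<integral>\<^sup>+ z. ennreal (norm (path_weight J (Suc k) x z * u (z (Suc k)))) \<partial>points (Suc k))
    \<le> (\<integral>\<^sup>+ z. ennreal (norm (path_weight J k x z)) * (M * C) \<partial>points k)"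
    unfolding nn_integral_path_Suc[OF u] by (intro nn_integral_mono mult_left_mono nn_integral_J_le C) simp
  also have "\<dots> \<le> M ^ k * (M * C)"
    using path_weight_measurable[of k x] nn_integral_path_weight_le[of k x]
    by (simp add: nn_integral_multc mult_right_mono)
  also have "\<dots> < \<infinity>"
    using M_finite C by (simp add: ennreal_mult_less_top power_less_top_ennreal)
  finally show "(\<integral>\<^sup>+ z. ennreal (norm (path_weight J (Suc k) x z * u (z (Suc k)))) \<partial>points (Suc k)) < \<infinity>" .
qed

text \<open>One operator is split off next to \<open>u\<close>, not at the outside: then the induction adds the new
  point at the end of the path and no coordinate has to be renumbered. This needs the claim for
  \<open>integral_op J u\<close>, which is again bounded.\<close>
lemma integral_op_funpow_eq_path_integral:
  assumes "u \<in> borel_measurable lebesgue" "C < \<infinity>" "AE y in lebesgue. ennreal (norm (u y)) \<le> C"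
  shows "(integral_op J ^^ k) u x = (\<integral>z. path_weight J k x z * u ((z(0 := x)) k) \<partial>points k)"
  using assms
proof (induction k arbitrary: u C)
  case 0
  have "points 0 = count_space {\<lambda>_. undefined}" by (simp add: PiM_empty)
  then show ?case
    by (simp only:) (simp add: path_weight_def lebesgue_integral_count_space_finite)
next
  case (Suc k)
  have "(integral_op J ^^ Suc k) u x = (integral_op J ^^ k) (integral_op J u) x"
    by (simp only: funpow_Suc_right o_apply)
  also have "\<dots> = (\<integral>z. path_weight J k x z * integral_op J u ((z(0 := x)) k) \<partial>points k)"
    using Suc.prems M_finite integral_op_bounded[OF Suc.prems(3)]
    by (intro Suc.IH[of _ "M * C"] integral_op_measurable J_measurable) (auto simp: ennreal_mult_less_top)
  also have "\<dots> = (\<integral>z. (\<integral>y. path_weight J (Suc k) x (z(Suc k := y)) * u y \<partial>lebesgue) \<partial>points k)"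
    by (simp only: path_weight_Suc_update integral_op_def mult.assoc integral_mult_right_zero)
  also have "\<dots> = (\<integral>z. path_weight J (Suc k) x z * u (z (Suc k)) \<partial>points (Suc k))"
    using path_integrand_integrable[OF Suc.prems] unfolding path_interval
    by (subst product_integral_insert) auto
  finally show ?case by simp
qed

text \<open>The end point of the path is innermost in the iterated integral for \<open>\<J>\<^sup>k u\<close>; Fubini's theorem moves it
  outside, and the integral over the intermediate points is the iterated kernel.\<close>
lemma integral_op_funpow_eq_iter_kernel:
  assumes u: "u \<in> borel_measurable lebesgue" "C < \<infinity>" "AE y in lebesgue. ennreal (norm (u y)) \<le> C"
  shows "(integral_op J ^^ Suc k) u x = (\<integral>y. iter_kernel J (Suc k) x y * u y \<partial>lebesgue)"
proof -
  interpret points: sigma_finite_measure "points k" by (rule sigma_finite) simp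
  interpret pair_sigma_finite "points k" "lebesgue :: 'a measure" ..
  define f where "f z = path_weight J (Suc k) x z * u (z (Suc k))" for z
  have int: "integrable (points (Suc k)) f"
    unfolding f_def by (rule path_integrand_integrable[OF u])
  have m: "(\<lambda>(z, y). f (z(Suc k := y))) \<in> borel_measurable (points k \<Otimes>\<^sub>M lebesgue)"
    using measurable_compose[OF measurable_add_dim[of "Suc k" "{1..<Suc k}" "\<lambda>_. lebesgue"]
        borel_measurable_integrable[OF int[unfolded path_interval]]]
    by (simp add: case_prod_beta')
  have "(\<integral>\<^sup>+ p. ennreal (norm (case p of (z, y) \<Rightarrow> f (z(Suc k := y)))) \<partial>(points k \<Otimes>\<^sub>M lebesgue))
      = (\<integral>\<^sup>+ z. \<integral>\<^sup>+ y. ennreal (norm (f (z(Suc k := y)))) \<partial>lebesgue \<partial>points k)"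
    using m by (subst lebesgue.nn_integral_fst[symmetric]) auto
  also have "\<dots> = (\<integral>\<^sup>+ z. ennreal (norm (f z)) \<partial>points (Suc k))"
    using borel_measurable_integrable[OF int] unfolding path_interval
    by (subst product_nn_integral_insert) auto
  also have "\<dots> < \<infinity>" using int by (simp add: integrable_iff_bounded)
  finally have pair: "integrable (points k \<Otimes>\<^sub>M lebesgue) (\<lambda>(z, y). f (z(Suc k := y)))"
    using m by (intro integrableI_bounded)
  have "(integral_op J ^^ Suc k) u x = (\<integral>z. f z \<partial>points (Suc k))"
    using integral_op_funpow_eq_path_integral[OF u, of "Suc k" x] by (simp add: f_def)
  also have "\<dots> = (\<integral>z. (\<integral>y. f (z(Suc k := y)) \<partial>lebesgue) \<partial>points k)"
    using int unfolding path_interval by (subst product_integral_insert) auto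
  also have "\<dots> = (\<integral>y. (\<integral>z. f (z(Suc k := y)) \<partial>points k) \<partial>lebesgue)"
    using Fubini_integral[OF pair] by simp
  also have "\<dots> = (\<integral>y. iter_kernel J (Suc k) x y * u y \<partial>lebesgue)"
    by (simp add: f_def iter_kernel_eq_path_weight)
  finally show ?thesis .
qed

lemma integral_op_funpow_kernel_bound:
  assumes u: "u \<in> borel_measurable lebesgue" "C < \<infinity>" "AE y in lebesgue. ennreal (norm (u y)) \<le> C"
    and k: "k > 0" and r: "r \<ge> 0" "\<And>y. norm (iter_kernel J k x y) \<le> r"
  shows "ennreal (norm ((integral_op J ^^ k) u x)) \<le> ennreal r * (\<integral>\<^sup>+ y. ennreal (norm (u y)) \<partial>lebesgue)"
proof -
  obtain k' where k': "k = Suc k'" using k gr0_conv_Suc by auto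
  have "ennreal (norm ((integral_op J ^^ k) u x)) \<le> (\<integral>\<^sup>+ y. ennreal (norm (iter_kernel J k x y * u y)) \<partial>lebesgue)"
    unfolding k' integral_op_funpow_eq_iter_kernel[OF u] by (rule ennreal_norm_integral_le)
  also have "\<dots> \<le> (\<integral>\<^sup>+ y. ennreal r * ennreal (norm (u y)) \<partial>lebesgue)"
    using r by (intro nn_integral_mono) (auto simp: norm_mult intro!: ennreal_leI mult_right_mono simp flip: ennreal_mult)
  also have "\<dots> = ennreal r * (\<integral>\<^sup>+ y. ennreal (norm (u y)) \<partial>lebesgue)"
    using u by (simp add: nn_integral_cmult)
  finally show ?thesis .
qed

end

section \<open>Decay of the solution\<close>

text \<open>The triangle inequality bounds the norm by a Poisson average of the \<open>b k\<close>, which is at most of the order of \<open>R t\<close>.\<close>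
lemma solution_asymp_le:
  fixes J :: "'a::euclidean_space \<Rightarrow> 'a \<Rightarrow> complex"
  assumes J: "(\<lambda>(x, y). J x y) \<in> borel_measurable (lebesgue \<Otimes>\<^sub>M lebesgue)"
    and u: "u\<^sub>0 \<in> borel_measurable lebesgue"
    and R: "regularly_varying a \<beta> R" and p: "p \<ge> 1"
    and D: "D \<ge> 0" and b: "\<And>k. b k > 0" "\<And>k. k \<ge> N \<Longrightarrow> b k \<le> D * R (real k)"
    and le: "\<And>k. Lp_norm p ((integral_op J ^^ k) u\<^sub>0) \<le> ennreal (b k)"
  obtains C X where "C > 0" "X > 0" "X \<ge> a"
    "\<And>t. t \<ge> X \<Longrightarrow> Lp_norm p (solution J 1 u\<^sub>0 t) \<le> ennreal (C * R t)"
proof -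
  obtain C X where CX: "C > 0" "X > 0" "X \<ge> a"
    and sum: "\<And>t. t \<ge> X \<Longrightarrow> summable (\<lambda>k. t ^ k / fact k * b k)"
    and avg: "\<And>t. t \<ge> X \<Longrightarrow> exp (- t) * (\<Sum>k. t ^ k / fact k * b k) \<le> C * R t"
    using poisson_average_regularly_varying[OF R D less_imp_le[OF b(1)] b(2)] by blast
  have "Lp_norm p (solution J 1 u\<^sub>0 t) \<le> ennreal (C * R t)" if t: "t \<ge> X" for t
  proof -
    have "Lp_norm p (solution J 1 u\<^sub>0 t) \<le> ennreal (exp (- t) * (\<Sum>k. t ^ k / fact k * b k))"
      unfolding solution_def mult_minus_left mult_1
      using CX t by (intro Lp_norm_series_le p integral_op_funpow_measurable J u le b(1) sum) auto
    also have "\<dots> \<le> ennreal (C * R t)" by (intro ennreal_leI avg t)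
    finally show ?thesis .
  qed
  then show ?thesis using that CX by blast
qed

theorem theorem3:
  fixes J :: "real ^ 'n \<Rightarrow> real ^ 'n \<Rightarrow> complex"
    and u\<^sub>0 :: "real ^ 'n \<Rightarrow> complex"
    and R L :: "real \<Rightarrow> real"
    and \<beta> N\<^sub>0 :: real
    and N :: nat
  assumes J_meas: "(\<lambda>(x, y). J x y) \<in> borel_measurable (lebesgue \<Otimes>\<^sub>M lebesgue)"
    and R: "regularly_varying N\<^sub>0 \<beta> R"
    and L: "slowly_varying N\<^sub>0 L"
    and R_eq: "\<And>s. s \<ge> N\<^sub>0 \<Longrightarrow> R s = s powr \<beta> * L s"
    and N: "N > 0" "real N \<ge> N\<^sub>0"
  shows
    "(u\<^sub>0 \<in> Lp_space 1 \<inter> Lp_space \<infinity> \<and>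
      (SUP x. \<integral>\<^sup>+ y. ennreal (norm (J x y)) \<partial>lebesgue) < \<infinity> \<and>
      (\<forall>k\<ge>N. \<forall>x y. norm (iter_kernel J k x y) \<le> R (real k))
      \<longrightarrow> asymp_le (\<lambda>t. Lp_norm \<infinity> (solution J 1 u\<^sub>0 t)) (\<lambda>t. t powr \<beta> * L t))
     \<and>
     (\<forall>p\<ge>1. u\<^sub>0 \<in> Lp_space p \<and>
      (\<forall>k\<in>{1..N - 1}. (integral_op J ^^ k) u\<^sub>0 \<in> Lp_space p) \<and>
      (\<forall>k\<ge>N. Lp_norm p ((integral_op J ^^ k) u\<^sub>0) \<le> ennreal (R (real k)))
      \<longrightarrow> asymp_le (\<lambda>t. Lp_norm p (solution J 1 u\<^sub>0 t)) (\<lambda>t. t powr \<beta> * L t))"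
proof -
  have R_pos: "R (real k) > 0" if "k \<ge> N" for k
    using R N that by (auto simp: regularly_varying_def)
  have reduce: "asymp_le (\<lambda>t. Lp_norm p (solution J 1 u\<^sub>0 t)) (\<lambda>t. t powr \<beta> * L t)"
    if bounds: "u\<^sub>0 \<in> borel_measurable lebesgue" "p \<ge> 1" "D \<ge> 0" "\<And>k. b k > 0"
      "\<And>k. k \<ge> N \<Longrightarrow> b k \<le> D * R (real k)"
      "\<And>k. Lp_norm p ((integral_op J ^^ k) u\<^sub>0) \<le> ennreal (b k)" for p D b
  proof -
    obtain C X where "C > 0" "X > 0" "X \<ge> N\<^sub>0"
      "\<And>t. t \<ge> X \<Longrightarrow> Lp_norm p (solution J 1 u\<^sub>0 t) \<le> ennreal (C * R t)"
      using solution_asymp_le[OF J_meas bounds(1) R bounds(2-6)] by blast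
    then show ?thesis
      unfolding asymp_le_def using R_eq by (intro exI[of _ C] exI[of _ X] conjI allI impI) auto
  qed
  show ?thesis
  proof (intro conjI allI impI)
    assume i: "u\<^sub>0 \<in> Lp_space 1 \<inter> Lp_space \<infinity> \<and>
      (SUP x. \<integral>\<^sup>+ y. ennreal (norm (J x y)) \<partial>lebesgue) < \<infinity> \<and>
      (\<forall>k\<ge>N. \<forall>x y. norm (iter_kernel J k x y) \<le> R (real k))"
    define M where "M = (SUP x. \<integral>\<^sup>+ y. ennreal (norm (J x y)) \<partial>lebesgue)"
    interpret bounded_kernel J M
      using i J_meas by unfold_locales (auto simp: M_def intro: SUP_upper)
    have u: "u\<^sub>0 \<in> borel_measurable lebesgue" using i by (simp add: Lp_space_def)
    define C where "C = Lp_norm \<infinity> u\<^sub>0"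
    have C: "C < \<infinity>" using i by (simp add: C_def Lp_space_def)
    have uC: "AE y in lebesgue. ennreal (norm (u\<^sub>0 y)) \<le> C"
      unfolding C_def Lp_norm_def by (simp add: esssup_AE)
    define I where "I = (\<integral>\<^sup>+ y. ennreal (norm (u\<^sub>0 y)) \<partial>lebesgue)"
    have I: "I < \<infinity>"
      using i by (auto simp: I_def Lp_space_def Lp_norm_def Let_def top.not_eq_extremum split: if_splits)
    \<comment> \<open>Adding 1 keeps the bounds positive, also if \<open>u\<^sub>0\<close> vanishes almost everywhere.\<close>
    define b where "b k = (if k < N then enn2real (M ^ k * C) + 1 else R (real k) * (enn2real I + 1))" for k
    show "asymp_le (\<lambda>t. Lp_norm \<infinity> (solution J 1 u\<^sub>0 t)) (\<lambda>t. t powr \<beta> * L t)"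
    proof (rule reduce[OF u, where b = b and D = "enn2real I + 1"])
      show "0 < b k" for k
        using R_pos[of k] by (simp add: b_def add_nonneg_pos)
      show "Lp_norm \<infinity> ((integral_op J ^^ k) u\<^sub>0) \<le> ennreal (b k)" for k
      proof (subst Lp_norm_infinity_le_iff)
        show "(integral_op J ^^ k) u\<^sub>0 \<in> borel_measurable lebesgue"
          by (intro integral_op_funpow_measurable J_meas u)
        show b0: "0 \<le> b k" using \<open>0 < b k\<close> by simp
        show "AE x in lebesgue. norm ((integral_op J ^^ k) u\<^sub>0 x) \<le> b k"
        proof (cases "k < N")
          case True
          have "M ^ k * C < \<infinity>"
            using C M_finite by (simp add: ennreal_mult_less_top power_less_top_ennreal)
          then have "M ^ k * C = ennreal (enn2real (M ^ k * C))" by simp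
          also have "\<dots> \<le> ennreal (b k)" using True by (simp add: b_def ennreal_leI)
          finally have *: "M ^ k * C \<le> ennreal (b k)" .
          have "r \<le> b k" if "ennreal r \<le> M ^ k * C" for r
            using order_trans[OF that *] b0 by simp
          then show ?thesis
            by (rule eventually_mono[OF integral_op_funpow_bounded[OF uC]])
        next
          case False
          have "ennreal (norm ((integral_op J ^^ k) u\<^sub>0 x)) \<le> ennreal (b k)" for x
          proof -
            have "ennreal (norm ((integral_op J ^^ k) u\<^sub>0 x)) \<le> ennreal (R (real k)) * I"
              unfolding I_def using False N i R_pos[of k]
              by (intro integral_op_funpow_kernel_bound[OF u C uC]) auto
            also have "I = ennreal (enn2real I)" using I by simp
            also have "ennreal (R (real k)) * ennreal (enn2real I) = ennreal (R (real k) * enn2real I)"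
              using False R_pos[of k] by (intro ennreal_mult[symmetric]) auto
            also have "\<dots> \<le> ennreal (b k)"
              using False R_pos[of k] by (intro ennreal_leI) (simp add: b_def)
            finally show ?thesis .
          qed
          then show ?thesis using b0 by simp
        qed
      qed
    qed (auto simp: b_def mult.commute)
  next
    fix p :: ennreal
    assume p: "p \<ge> 1"
      and ii: "u\<^sub>0 \<in> Lp_space p \<and>
        (\<forall>k\<in>{1..N - 1}. (integral_op J ^^ k) u\<^sub>0 \<in> Lp_space p) \<and>
        (\<forall>k\<ge>N. Lp_norm p ((integral_op J ^^ k) u\<^sub>0) \<le> ennreal (R (real k)))"
    have u: "u\<^sub>0 \<in> borel_measurable lebesgue" using ii by (simp add: Lp_space_def)
    let ?n = "\<lambda>k. Lp_norm p ((integral_op J ^^ k) u\<^sub>0)"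
    define b where "b k = (if k < N then enn2real (?n k) + 1 else R (real k))" for k
    show "asymp_le (\<lambda>t. Lp_norm p (solution J 1 u\<^sub>0 t)) (\<lambda>t. t powr \<beta> * L t)"
    proof (rule reduce[OF u p, where b = b and D = 1])
      show "0 < b k" for k
        using R_pos[of k] by (simp add: b_def add_nonneg_pos)
      show "?n k \<le> ennreal (b k)" for k
      proof (cases "k < N")
        case True
        then have "(integral_op J ^^ k) u\<^sub>0 \<in> Lp_space p"
          using ii by (cases "k = 0") auto
        then have "?n k = ennreal (enn2real (?n k))" by (simp add: Lp_space_def)
        also have "\<dots> \<le> ennreal (b k)" using True by (simp add: b_def ennreal_leI)
        finally show ?thesis .
      next
        case False
        then show ?thesis using ii by (simp add: b_def)
      qed
    qed (auto simp: b_def)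
  qed
qed

end
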